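(* Let $\mathbf{s}$ be a standard episturmian word over a finite alphabet $\mathcal{A}$ whose directive word is $\Delta(\mathbf{s})=x_1x_2x_3\cdots=y_1^{d_1}y_2^{d_2}y_3^{d_3}\cdots$, where $x_i,y_i\in\mathcal{A}$, $d_i\ge1$ are integers and $y_i\neq y_{i+1}$ for all $i\ge1$. For $m\ge1$ put $g(m)=d_1+\cdots+d_{m-1}+1$. Let $c(\mathbf{s})=(c_1,c_2,\ldots)$ be the Crochemore factorization of $\mathbf{s}$. Then there exist integers $i$ and $j$ such that $c_1c_2\cdots c_k=u_{g(k-j+i+1)}$ for every $k\ge j$. Consequently, $c_k=\big(\overline{h_{g(k-j+i)-1}}\big)^{d_{k-j+i}}$ for all $k\ge j$.
   Context: Words: $\overline{w}$ denotes the reversal of $w$; $w$ is a palindrome if $w=\overline w$. An infinite word is episturmian if its set of factors is closed under reversal and for each length $\ell$ it has at most one right special factor of length $\ell$; it is standard if all its left special factors are prefixes of it. For a word $w$, $w^{(+)}$ is the shortest palindrome having $w$ as a prefix. If $u_1=\varepsilon,u_2,u_3,\ldots$ is the sequence of palindromic prefixes of a standard episturmian word $\mathbf{s}$ (in increasing length), there is an infinite word $\Delta(\mathbf{s})=x_1x_2\cdots$ (its directive word) with $u_{n+1}=(u_nx_n)^{(+)}$ for all $n\ge1$; $\mathbf s$ is the infinite word having every $u_n$ as a prefix. For $a\in\mathcal A$ let $\psi_a$ be the morphism with $\psi_a(a)=a$ and $\psi_a(x)=ax$ for $x\neq a$; let $\mu_0=\mathrm{Id}$, $\mu_n=\psi_{x_1}\cdots\psi_{x_n}$,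 and $h_n=\mu_n(x_{n+1})$ for $n\ge0$. (Known: $u_{n+1}=h_{n-1}u_n$ for $n\ge1$.) Crochemore factorization: the c-factorization of an infinite word $\mathbf w$ is $c(\mathbf w)=(c_1,c_2,\ldots)$ with $\mathbf w=c_1c_2\cdots$, where each $c_m$ is either the longest prefix of $c_mc_{m+1}\cdots$ occurring at least twice (as a factor) in $c_1\cdots c_m$, or, if no nonempty such prefix exists, a letter $a$ which does not occur in $c_1\cdots c_{m-1}$. *)

theory Defs
  imports "HOL-Library.Infinite_Set" "HOL-Library.Sublist"
begin

text \<open>
  Finite words are lists. An infinite word w = w_1 w_2 w_3 ... is a function on the
  positive integers, encoded as a function on nat whose value at 0 is not part of the
  word. All other sequences that start at index 1 (such as the palindromic prefixes u_n)
  are encoded in the same way; nothing below reads their value at 0.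
\<close>

type_synonym 'a iword = "nat \<Rightarrow> 'a"

definition word_over :: "'a set \<Rightarrow> 'a iword \<Rightarrow> bool" where
  "word_over A w \<longleftrightarrow> (\<forall>n\<ge>1. w n \<in> A)"

text \<open>The word w_{i+1} ... w_{i+n} of length n.\<close>

definition subword :: "'a iword \<Rightarrow> nat \<Rightarrow> nat \<Rightarrow> 'a list" where
  "subword w i n = map w [i+1..<i+n+1]"

definition factor :: "'a list \<Rightarrow> 'a iword \<Rightarrow> bool" where
  "factor v w \<longleftrightarrow> (\<exists>i. v = subword w i (length v))"

definition iprefix :: "'a list \<Rightarrow> 'a iword \<Rightarrow> bool" where
  "iprefix v w \<longleftrightarrow> v = subword w 0 (length v)"

definition palindrome :: "'a list \<Rightarrow> bool" where
  "palindrome v \<longleftrightarrow> v = rev v"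

definition right_special :: "'a list \<Rightarrow> 'a iword \<Rightarrow> bool" where
  "right_special v w \<longleftrightarrow> (\<exists>a b. a \<noteq> b \<and> factor (v @ [a]) w \<and> factor (v @ [b]) w)"

definition left_special :: "'a list \<Rightarrow> 'a iword \<Rightarrow> bool" where
  "left_special v w \<longleftrightarrow> (\<exists>a b. a \<noteq> b \<and> factor (a # v) w \<and> factor (b # v) w)"

definition episturmian :: "'a iword \<Rightarrow> bool" where
  "episturmian w \<longleftrightarrow>
     (\<forall>v. factor v w \<longrightarrow> factor (rev v) w) \<and>
     (\<forall>v v'. right_special v w \<longrightarrow> right_special v' w \<longrightarrow> length v = length v' \<longrightarrow> v = v')"

definition standard_episturmian :: "'a iword \<Rightarrow> bool" where
  "standard_episturmian w \<longleftrightarrow>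
     episturmian w \<and> (\<forall>v. left_special v w \<longrightarrow> iprefix v w)"

definition pal_closure :: "'a list \<Rightarrow> 'a list" where
  "pal_closure v = (ARG_MIN length p. palindrome p \<and> prefix v p)"

text \<open>
  The word u_n: the n-th palindromic prefix in increasing order of length, so that u_1 is
  the empty word.
\<close>

definition pal_prefix :: "'a iword \<Rightarrow> nat \<Rightarrow> 'a list" where
  "pal_prefix w n = subword w 0 (enumerate {l. palindrome (subword w 0 l)} (n - 1))"

text \<open>
  If w had only finitely many palindromic prefixes, the sequence u_n would be eventually
  constant, and since the closure of u_n x_n is longer than u_n, no x would satisfy the
  next predicate.
\<close>

definition directive_word :: "'a iword \<Rightarrow> 'a iword \<Rightarrow> bool" where
  "directive_word w x \<longleftrightarrow>
     (\<forall>n\<ge>1. pal_prefix w (n + 1) = pal_closure (pal_prefix w n @ [x n]))"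

definition psi :: "'a \<Rightarrow> 'a list \<Rightarrow> 'a list" where
  "psi a v = concat (map (\<lambda>b. if b = a then [a] else [a, b]) v)"

fun mu :: "'a iword \<Rightarrow> nat \<Rightarrow> 'a list \<Rightarrow> 'a list" where
  "mu x 0 = id"
| "mu x (Suc n) = mu x n \<circ> psi (x (Suc n))"

definition h :: "'a iword \<Rightarrow> nat \<Rightarrow> 'a list" where
  "h x n = mu x n [x (n + 1)]"

definition word_power :: "'a list \<Rightarrow> nat \<Rightarrow> 'a list" where
  "word_power v n = concat (replicate n v)"

definition product_upto :: "(nat \<Rightarrow> 'a list) \<Rightarrow> nat \<Rightarrow> 'a list" where
  "product_upto v n = concat (map v [1..<n+1])"

text \<open>The second conjunct is needed because the v_n may be empty: the finite products must exhaust w.\<close>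

definition infinite_product :: "'a iword \<Rightarrow> (nat \<Rightarrow> 'a list) \<Rightarrow> bool" where
  "infinite_product w v \<longleftrightarrow>
     (\<forall>n. iprefix (product_upto v n) w) \<and> (\<forall>N. \<exists>n. N \<le> length (product_upto v n))"

definition occurrences :: "'a list \<Rightarrow> 'a list \<Rightarrow> nat set" where
  "occurrences p v = {i. i + length p \<le> length v \<and> take (length p) (drop i v) = p}"

text \<open>
  The candidates for the next factor after c_1 ... c_{m-1} = q: the nonempty prefixes p of
  the remaining part of w (so q p is a prefix of w) that occur at least twice in q p. The two
  occurrences may overlap.
\<close>

definition repeated_next :: "'a iword \<Rightarrow> 'a list \<Rightarrow> 'a list \<Rightarrow> bool" where
  "repeated_next w q p \<longleftrightarrow>
     p \<noteq> [] \<and> iprefix (q @ p) w \<and> card (occurrences p (q @ p)) \<ge> 2"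

definition crochemore_factorization :: "'a iword \<Rightarrow> (nat \<Rightarrow> 'a list) \<Rightarrow> bool" where
  "crochemore_factorization w c \<longleftrightarrow>
     infinite_product w c \<and>
     (\<forall>m\<ge>1. let q = product_upto c (m - 1) in
        if \<exists>p. repeated_next w q p
        then is_arg_max length (repeated_next w q) (c m)
        else (\<exists>a. a \<notin> set q \<and> c m = [a]))"

definition g :: "(nat \<Rightarrow> nat) \<Rightarrow> nat \<Rightarrow> nat" where
  "g d m = (\<Sum>i=1..<m. d i) + 1"

end

theory Submission
  imports Defs
begin

text \<open>
  A factor that occurs twice can be extended to the left until it becomes left special, hence a
  prefix of s. Applied inside a palindromic prefix this shows that if \<open>v x\<^sub>n\<close>, with v a suffix of
  \<open>u\<^sub>n\<close>, has occurred before, then v is no longer than some \<open>u\<^sub>k\<close> with \<open>k < n\<close> and \<open>x\<^sub>k = x\<^sub>n\<close>. Over a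
  block \<open>y\<^sub>m\<^sup>d\<close> of the directive word the palindromic prefix grows by d copies of the reversal of
  \<open>h\<close>. If \<open>y\<^sub>m\<close> has been used before, these d copies also occur one period earlier, and they are too
  long to be continued by \<open>y\<^sub>m\<^sub>+\<^sub>1\<close>, so they form exactly one factor. A new letter \<open>y\<^sub>m\<close> contributes
  one more factor, namely itself; over a finite alphabet this happens finitely often.
\<close>

section \<open>Factors and prefixes of infinite words\<close>

lemma length_subword [simp]: "length (subword w i n) = n"
  by (simp add: subword_def)

lemma subword_0 [simp]: "subword w i 0 = []"
  by (simp add: subword_def)

lemma subword_Suc: "subword w i (Suc n) = subword w i n @ [w (i + n + 1)]"
  by (simp add: subword_def)

lemma subword_Cons: "subword w i (Suc n) = w (Suc i) # subword w (Suc i) n"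
  by (simp add: subword_def upt_conv_Cons del: upt_Suc)

lemma subword_add: "subword w i (m + n) = subword w i m @ subword w (i + m) n"
  by (induction n) (simp_all add: subword_Suc add.assoc)

lemma nth_subword [simp]: "k < n \<Longrightarrow> subword w i n ! k = w (i + k + 1)"
  by (simp add: subword_def del: upt_Suc)

lemma factor_subword: "factor (subword w i n) w"
  unfolding factor_def by (rule exI[of _ i]) simp

lemma iprefix_subword: "iprefix (subword w 0 n) w"
  by (simp add: iprefix_def)

lemma iprefix_append: "iprefix (p @ q) w \<longleftrightarrow> iprefix p w \<and> q = subword w (length p) (length q)"
  unfolding iprefix_def by (simp add: subword_add)

lemma iprefix_prefix: "prefix p q \<Longrightarrow> iprefix q w \<Longrightarrow> iprefix p w"
  by (auto simp: prefix_def iprefix_append)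

lemma iprefix_length_eq: "iprefix p w \<Longrightarrow> iprefix q w \<Longrightarrow> length p = length q \<Longrightarrow> p = q"
  by (metis iprefix_def)

lemma iprefix_length_le:
  assumes "iprefix p w" "iprefix q w" "length p \<le> length q" shows "prefix p q"
proof -
  have "iprefix (take (length p) q) w"
    using assms(2) iprefix_prefix take_is_prefix by blast
  then show ?thesis
    using assms by (metis iprefix_length_eq length_take min.absorb2 take_is_prefix)
qed

section \<open>Palindromic closure, the morphisms, enumeration of finite sets\<close>

lemma palindrome_closure_exists: "\<exists>p. palindrome p \<and> prefix v p"
  by (rule exI[of _ "v @ rev v"]) (simp add: palindrome_def)

lemma pal_closure_props:
  shows palindrome_pal_closure: "palindrome (pal_closure v)"
    and prefix_pal_closure: "prefix v (pal_closure v)"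
    and pal_closure_minimal: "palindrome p \<Longrightarrow> prefix v p \<Longrightarrow> length (pal_closure v) \<le> length p"
proof -
  obtain p0 where p0: "palindrome p0 \<and> prefix v p0"
    using palindrome_closure_exists by blast
  show "palindrome (pal_closure v)" "prefix v (pal_closure v)"
    unfolding pal_closure_def using arg_min_natI[of "\<lambda>p. palindrome p \<and> prefix v p", OF p0] by auto
  show "palindrome p \<Longrightarrow> prefix v p \<Longrightarrow> length (pal_closure v) \<le> length p"
    unfolding pal_closure_def
    using arg_min_nat_le[of "\<lambda>p. palindrome p \<and> prefix v p" p length] by auto
qed

text \<open>Reversing \<open>p\<close> turns its suffix \<open>q\<close> into a prefix
  \<open>rev q\<close> of the same length as the prefix \<open>q\<close>.\<close>

lemma palindrome_border: "palindrome p \<Longrightarrow> p = q @ b \<Longrightarrow> p = a @ q \<Longrightarrow> palindrome q"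
proof -
  assume p: "palindrome p" "p = q @ b" "p = a @ q"
  then have "q @ b = rev (a @ q)" by (metis palindrome_def)
  then show "palindrome q" by (simp add: palindrome_def)
qed

lemma psi_append: "psi a (v @ w) = psi a v @ psi a w"
  by (simp add: psi_def)

lemma mu_append: "mu x n (v @ w) = mu x n v @ mu x n w"
  by (induction n arbitrary: v w) (simp_all add: psi_append)

text \<open>Each step removes the least element; once the set is exhausted, \<open>enumerate\<close>
  keeps returning its default value on the empty set. This is what rules out finitely many
  palindromic prefixes.\<close>

lemma enumerate_finite_eventually_const:
  fixes S :: "nat set"
  assumes "finite S" shows "\<exists>N. \<forall>n\<ge>N. enumerate S (Suc n) = enumerate S n"
  using assms
proof (induction "card S" arbitrary: S)
  case 0
  then have "S = {}" by simp
  then have "enumerate S (Suc n) = enumerate S n" for n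
    by (simp add: enumerate_Suc)
  then show ?case by blast
next
  case (Suc m)
  then have "S \<noteq> {}" by auto
  then have "(LEAST n. n \<in> S) \<in> S" by (meson LeastI_ex ex_in_conv)
  then have "m = card (S - {LEAST n. n \<in> S})" using Suc by simp
  from Suc(1)[OF this] Suc.prems obtain N
    where N: "\<forall>n\<ge>N. enumerate (S - {LEAST n. n \<in> S}) (Suc n) = enumerate (S - {LEAST n. n \<in> S}) n"
    by auto
  have "enumerate S (Suc n) = enumerate S n" if "n \<ge> Suc N" for n
  proof -
    obtain k where "n = Suc k" "k \<ge> N" using \<open>n \<ge> Suc N\<close> by (cases n) auto
    then show ?thesis using N enumerate_Suc[of S "Suc k"] enumerate_Suc[of S k] by simp
  qed
  then show ?case by blast
qed

text \<open>Two equal factors at different positions are extended to the left until they differ;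
  at that point the common factor is left special.\<close>

lemma standard_extend_left:
  assumes "standard_episturmian s" "i < j" "subword s i l = subword s j l"
  shows "\<exists>t\<le>i. iprefix (subword s (j - t) (l + t)) s"
  using assms(2,3)
proof (induction i arbitrary: j l)
  case 0
  then show ?case by (metis iprefix_subword le_refl diff_zero add_0_right)
next
  case (Suc i)
  then obtain j' where j: "j = Suc j'" "i < j'" by (cases j) auto
  show ?case
  proof (cases "s (Suc i) = s j")
    case True
    then have "subword s i (Suc l) = subword s j' (Suc l)"
      using Suc.prems j by (simp add: subword_Cons)
    from Suc.IH[OF j(2) this] obtain t where "t \<le> i" "iprefix (subword s (j' - t) (Suc l + t)) s"
      by auto
    then show ?thesis using j by (intro exI[of _ "Suc t"]) auto
  next
    case False
    have "factor (s (Suc i) # subword s j l) s" "factor (s j # subword s j l) s"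
      using factor_subword[of s i "Suc l"] factor_subword[of s j' "Suc l"] Suc.prems j
      by (simp_all add: subword_Cons)
    then have "left_special (subword s j l) s"
      unfolding left_special_def using False by blast
    then have "iprefix (subword s j l) s"
      using assms(1) by (simp add: standard_episturmian_def)
    then show ?thesis by (intro exI[of _ 0]) simp
  qed
qed

text \<open>In this locale all indices are shifted down by one, so that \<open>U n\<close> and \<open>X n\<close> stand for
  \<open>u\<^sub>n\<^sub>+\<^sub>1\<close> and \<open>x\<^sub>n\<^sub>+\<^sub>1\<close>.\<close>

locale directed_word =
  fixes s x :: "'a iword"
  assumes standard: "standard_episturmian s"
    and directive: "directive_word s x"
begin

section \<open>Palindromic prefixes and their borders\<close>

definition U :: "nat \<Rightarrow> 'a list" where "U n = pal_prefix s (Suc n)"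

definition X :: "nat \<Rightarrow> 'a" where "X n = x (Suc n)"

abbreviation pal_lengths :: "nat set" where
  "pal_lengths \<equiv> {l. palindrome (subword s 0 l)}"

lemma U_enumerate: "U n = subword s 0 (enumerate pal_lengths n)"
  by (simp add: U_def pal_prefix_def)

lemma U_Suc_closure: "U (Suc n) = pal_closure (U n @ [X n])"
  using directive[unfolded directive_word_def, rule_format, of "Suc n"] by (simp add: U_def X_def)

lemma prefix_U_Suc: "prefix (U n @ [X n]) (U (Suc n))"
  unfolding U_Suc_closure by (rule prefix_pal_closure)

lemma infinite_pal_lengths: "infinite pal_lengths"
proof
  assume "finite pal_lengths"
  from enumerate_finite_eventually_const[OF this] obtain N
    where "\<forall>n\<ge>N. enumerate pal_lengths (Suc n) = enumerate pal_lengths n" by blast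
  then have "U (Suc N) = U N" by (simp only: U_enumerate order_refl)
  then show False using prefix_U_Suc[of N] by (auto dest: prefix_length_le)
qed

lemma palindrome_U: "palindrome (U n)"
  using enumerate_in_set[OF infinite_pal_lengths, of n] by (simp add: U_enumerate)

lemma rev_U [simp]: "rev (U n) = U n"
  using palindrome_U[of n] unfolding palindrome_def by (rule sym)

lemma iprefix_U: "iprefix (U n) s"
  by (simp add: U_enumerate iprefix_subword)

lemma iprefix_U_X: "iprefix (U n @ [X n]) s"
  using iprefix_prefix prefix_U_Suc iprefix_U by blast

lemma length_U_less_iff: "length (U k) < length (U n) \<longleftrightarrow> k < n"
  using enumerate_mono_iff[OF infinite_pal_lengths] by (simp add: U_enumerate)

lemma length_U_le_iff: "length (U k) \<le> length (U n) \<longleftrightarrow> k \<le> n"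
  using length_U_less_iff by (meson linorder_not_le)

lemma U_0 [simp]: "U 0 = []"
proof -
  have "palindrome (subword s 0 0)" by (simp add: subword_def palindrome_def)
  then have "(LEAST l. l \<in> pal_lengths) = 0" by (intro Least_eq_0) simp
  then show ?thesis by (simp add: U_enumerate enumerate_0 subword_def)
qed

lemma palindromic_prefix_is_U:
  assumes "iprefix p s" "palindrome p" shows "\<exists>k. p = U k"
proof -
  have "length p \<in> pal_lengths" using assms by (simp add: iprefix_def)
  then obtain k where "length p = enumerate pal_lengths k"
    using enumerate_Ex[of pal_lengths] by (metis infinite_pal_lengths)
  then show ?thesis using assms(1) unfolding iprefix_def U_enumerate by metis
qed

text \<open>A suffix of the palindrome \<open>U n\<close> that is also a prefix of \<open>s\<close>
  is a border, hence itself a palindrome and so some \<open>U k\<close>. The letter after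
  \<open>U k\<close> in \<open>s\<close> can only be \<open>X k\<close>.\<close>

lemma border_of_U:
  assumes "U n = a @ q" "a \<noteq> []" "iprefix (q @ [z]) s"
  shows "\<exists>k<n. q = U k \<and> X k = z"
proof -
  have q: "iprefix q s" using assms(3) by (simp add: iprefix_append)
  have "length q \<le> length (U n)" using assms(1) by simp
  then obtain b where "U n = q @ b"
    using iprefix_length_le[OF q iprefix_U] by (auto elim: prefixE)
  then have "palindrome q" using palindrome_border[OF palindrome_U] assms(1) by blast
  then obtain k where k: "q = U k" using palindromic_prefix_is_U q by blast
  moreover have "k < n" using assms k by (metis length_U_less_iff length_append length_greater_0_conv less_add_same_cancel2)
  moreover have "U k @ [X k] = q @ [z]"
    using iprefix_length_eq[OF iprefix_U_X assms(3)] k by simp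
  ultimately show ?thesis by auto
qed

lemma U_suffix:
  assumes "k < n" shows "\<exists>w. w \<noteq> [] \<and> U n = w @ U k \<and> U n = U k @ rev w"
proof -
  have "length (U k) < length (U n)" using assms by (simp add: length_U_less_iff)
  moreover from this have "prefix (U k) (U n)"
    using iprefix_length_le[OF iprefix_U iprefix_U] by simp
  ultimately obtain b where b: "U n = U k @ b" "b \<noteq> []" by (auto elim: prefixE)
  then have "U n = rev b @ U k" by (metis rev_U rev_append)
  then show ?thesis using b by (intro exI[of _ "rev b"]) simp
qed

section \<open>Growth of the palindromic prefixes\<close>

text \<open>The case distinction that governs the closure of \<open>U n @ [a]\<close>: the longest
  palindromic suffix of \<open>U n\<close> preceded by \<open>a\<close> is \<open>U r\<close>, or,
  if \<open>a\<close> is \<open>fresh\<close>, there is none.\<close>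

definition last_occ :: "nat \<Rightarrow> 'a \<Rightarrow> nat \<Rightarrow> bool" where
  "last_occ n a r \<longleftrightarrow> r < n \<and> X r = a \<and> (\<forall>k<n. X k = a \<longrightarrow> k \<le> r)"

definition fresh :: "nat \<Rightarrow> 'a \<Rightarrow> bool" where
  "fresh n a \<longleftrightarrow> (\<forall>k<n. X k \<noteq> a)"

lemma last_occ_or_fresh: "(\<exists>r. last_occ n a r) \<or> fresh n a"
proof (cases "fresh n a")
  case False
  then obtain k where k: "k < n \<and> X k = a" unfolding fresh_def by blast
  define r where "r = (GREATEST k. k < n \<and> X k = a)"
  have "r < n \<and> X r = a" unfolding r_def by (rule GreatestI_nat[where P = "\<lambda>k. k < n \<and> X k = a", OF k, of n]) auto
  moreover have "\<forall>k<n. X k = a \<longrightarrow> k \<le> r"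
    unfolding r_def using Greatest_le_nat[of "\<lambda>k. k < n \<and> X k = a" _ n] by fastforce
  ultimately show ?thesis unfolding last_occ_def by blast
qed simp

text \<open>Here \<open>b\<close> is the increment on the left. If it fits inside
  \<open>U n\<close>, cancelling \<open>b\<close> in the two forms of \<open>U (Suc n)\<close> shows
  that the remainder \<open>q\<close> is followed by \<open>X n\<close> in \<open>s\<close>, so
  \<open>border_of_U\<close> applies. This bounds \<open>b\<close> from below.\<close>

lemma U_Suc_split:
  obtains b c where "U (Suc n) = b @ U n" "U (Suc n) = U n @ X n # c" "b \<noteq> []"
    "\<And>q. U n = b @ q \<Longrightarrow> \<exists>k<n. q = U k \<and> X k = X n"
proof -
  obtain c where c: "U (Suc n) = U n @ X n # c"
    using prefix_U_Suc[of n] by (auto elim: prefixE)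
  obtain b where b: "b \<noteq> []" "U (Suc n) = b @ U n" using U_suffix[of n "Suc n"] by auto
  have "\<exists>k<n. q = U k \<and> X k = X n" if q: "U n = b @ q" for q
  proof -
    have "b @ U n = b @ q @ X n # c" using q b c by simp
    then have "U n = (q @ [X n]) @ c" by simp
    then have "iprefix (q @ [X n]) s" by (metis iprefix_U iprefix_append)
    then show ?thesis using border_of_U q b(1) by blast
  qed
  then show ?thesis using that b c by blast
qed

text \<open>The word \<open>w @ U n\<close> is a palindrome starting with
  \<open>U n @ [X n]\<close>, so by minimality \<open>b\<close> is no longer than \<open>w\<close>.
  Conversely, the remainder of \<open>U n\<close> after \<open>b\<close> is some \<open>U k\<close>
  with \<open>X k = X n\<close>, which cannot be longer than \<open>U r\<close>.\<close>

lemma U_Suc_last_occ: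
  assumes "last_occ n (X n) r" "U n = w @ U r"
  shows "U (Suc n) = w @ U n"
proof -
  obtain b c where b: "U (Suc n) = b @ U n" "U (Suc n) = U n @ X n # c" "b \<noteq> []"
    and border: "\<And>q. U n = b @ q \<Longrightarrow> \<exists>k<n. q = U k \<and> X k = X n"
    using U_Suc_split by blast
  have r: "r < n" "X r = X n" using assms(1) by (auto simp: last_occ_def)
  have Un: "U n = U r @ rev w" using assms(2) by (metis rev_U rev_append)
  have "prefix (U r @ [X r]) (U n)"
    using r(1) by (intro iprefix_length_le[OF iprefix_U_X iprefix_U])
      (simp add: length_U_less_iff Suc_le_eq)
  then obtain t where "rev w = X n # t" using Un r(2) by (auto elim: prefixE)
  then have "prefix (U n @ [X n]) (w @ U n)"
    by (metis Un assms(2) append.assoc append_Cons append_Nil prefixI)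
  moreover have "palindrome (w @ U n)"
    unfolding palindrome_def using Un assms(2) by (metis append.assoc rev_U rev_append rev_rev_ident)
  ultimately have "length (U (Suc n)) \<le> length (w @ U n)"
    unfolding U_Suc_closure by (intro pal_closure_minimal)
  then have le: "length b \<le> length w" using b by simp
  have "length w \<le> length b"
  proof -
    have "prefix b (U n)"
      using b le assms(2)
      by (intro iprefix_length_le[of _ s] iprefix_U)
        (metis iprefix_U iprefix_append, simp)
    then obtain q where q: "U n = b @ q" by (auto elim: prefixE)
    then obtain k where "k < n" "q = U k" "X k = X n" using border by blast
    then have "length q \<le> length (U r)"
      using assms(1) by (simp add: last_occ_def length_U_le_iff)
    moreover have "length b + length q = length w + length (U r)"
      using q assms(2) by (metis length_append)
    ultimately show ?thesis by simp
  qed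
  then have "b = w"
    using le b assms(2) iprefix_U[of "Suc n"] iprefix_U[of n]
    by (metis iprefix_append iprefix_length_eq le_antisym)
  then show ?thesis using b by simp
qed

text \<open>Now the competing palindrome is \<open>U n @ X n # U n\<close>, and an increment
  \<open>b\<close> no longer than \<open>U n\<close> would reveal an earlier index carrying
  \<open>X n\<close>.\<close>

lemma U_Suc_fresh:
  assumes "fresh n (X n)" shows "U (Suc n) = U n @ X n # U n"
proof -
  obtain b c where b: "U (Suc n) = b @ U n" "U (Suc n) = U n @ X n # c" "b \<noteq> []"
    and border: "\<And>q. U n = b @ q \<Longrightarrow> \<exists>k<n. q = U k \<and> X k = X n"
    using U_Suc_split by blast
  have "palindrome (U n @ X n # U n)" "prefix (U n @ [X n]) (U n @ X n # U n)"
    unfolding palindrome_def by simp_all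
  then have "length (U (Suc n)) \<le> length (U n @ X n # U n)"
    unfolding U_Suc_closure by (intro pal_closure_minimal)
  then have le: "length b \<le> Suc (length (U n))" using b by simp
  have bp: "iprefix b s" using b by (metis iprefix_U iprefix_append)
  have "\<not> length b \<le> length (U n)"
  proof
    assume "length b \<le> length (U n)"
    from iprefix_length_le[OF bp iprefix_U this] obtain q where "U n = b @ q"
      by (auto elim: prefixE)
    then show False using border assms by (auto simp: fresh_def)
  qed
  then have "b = U n @ [X n]"
    using le by (intro iprefix_length_eq[OF bp iprefix_U_X]) simp
  then show ?thesis using b by simp
qed

section \<open>The words \<open>h\<close> as increments of the palindromic prefixes\<close>

text \<open>Both cases go through one induction, because the step for any letter needs
  \<open>mu x n [X n]\<close>, and \<open>X n\<close> may be of either kind. In the first case the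
  image of \<open>a\<close> is \<open>U n\<close> with its suffix \<open>U r\<close>
  removed.\<close>

lemma mu_letter:
  shows "last_occ n a r \<Longrightarrow> mu x n [a] @ U r = U n"
    and "fresh n a \<Longrightarrow> mu x n [a] = U n @ [a]"
proof (induction n arbitrary: a r)
  case 0
  { case 1 then show ?case by (simp add: last_occ_def) }
  { case 2 then show ?case by simp }
next
  case (Suc n)
  have step: "U (Suc n) = mu x n [X n] @ U n"
    using last_occ_or_fresh[of n "X n"]
  proof
    assume "\<exists>r. last_occ n (X n) r"
    then show ?thesis using Suc.IH(1) U_Suc_last_occ by metis
  next
    assume "fresh n (X n)"
    then show ?thesis using Suc.IH(2) U_Suc_fresh by simp
  qed
  have mu_Suc: "mu x (Suc n) [a] = (if a = X n then mu x n [a] else mu x n [X n] @ mu x n [a])" for a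
    using mu_append[of x n "[X n]" "[a]"] by (simp add: psi_def X_def)
  {
    case 1
    show ?case
    proof (cases "a = X n")
      case True
      then have "r = n" using 1 by (auto simp: last_occ_def)
      then show ?thesis using True step mu_Suc by simp
    next
      case False
      then have "last_occ n a r" using 1 by (auto simp: last_occ_def less_Suc_eq)
      then show ?thesis using Suc.IH(1) step mu_Suc False by simp
    qed
  next
    case 2
    then have "a \<noteq> X n" "fresh n a" by (auto simp: fresh_def)
    then show ?case using Suc.IH(2) step mu_Suc by simp
  }
qed

lemma h_last_occ: "last_occ n (X n) r \<Longrightarrow> h x n @ U r = U n"
  using mu_letter(1) by (simp add: h_def X_def)

lemma h_fresh: "fresh n (X n) \<Longrightarrow> h x n = U n @ [X n]"
  using mu_letter(2) by (simp add: h_def X_def)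

lemma U_Suc: "U (Suc n) = h x n @ U n"
  using last_occ_or_fresh[of n "X n"]
proof
  assume "\<exists>r. last_occ n (X n) r"
  then obtain r where r: "last_occ n (X n) r" by blast
  then show ?thesis by (rule U_Suc_last_occ) (simp add: h_last_occ[OF r])
next
  assume "fresh n (X n)"
  then show ?thesis by (simp add: U_Suc_fresh h_fresh)
qed

lemma U_Suc_rev: "U (Suc n) = U n @ rev (h x n)"
  using arg_cong[OF U_Suc[of n], of rev] by simp

text \<open>Each \<open>psi a\<close> fixes the letter \<open>a\<close>; hence the increment stays
  the same throughout a run of equal letters.\<close>

lemma h_Suc: "X (Suc n) = X n \<Longrightarrow> h x (Suc n) = h x n"
  by (simp add: h_def X_def psi_def)

lemma run_U:
  assumes "\<And>t. t < d \<Longrightarrow> X (m + t) = X m"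
  shows "U (m + d) = U m @ word_power (rev (h x m)) d"
proof -
  have h: "h x (m + t) = h x m" if "t < d" for t
    using that
  proof (induction t)
    case (Suc t)
    then have "X (Suc (m + t)) = X (m + t)" using assms[of "Suc t"] assms[of t] by simp
    then show ?case using Suc h_Suc by simp
  qed simp
  have "t \<le> d \<Longrightarrow> U (m + t) = U m @ word_power (rev (h x m)) t" for t
  proof (induction t)
    case (Suc t)
    then have "U (m + Suc t) = U m @ word_power (rev (h x m)) t @ rev (h x m)"
      using h[of t] U_Suc_rev[of "m + t"] by simp
    then show ?case by (simp add: word_power_def flip: replicate_append_same)
  qed (simp add: word_power_def)
  then show ?thesis by simp
qed

text \<open>By symmetry let \<open>t < r\<close>. If \<open>X r\<close> last occurred at
  \<open>k\<close>, then \<open>U (Suc r)\<close> has twice the length of \<open>U r\<close> minus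
  that of \<open>U k\<close>, and the induction hypothesis for \<open>t\<close> and \<open>k\<close>
  below \<open>r\<close> gives the bound. The lemma serves to show that the factor of a run cannot
  be prolonged by the next letter.\<close>

lemma length_U_two_letters:
  assumes "t < m" "r < m" "X t \<noteq> X r"
  shows "length (U t) + length (U r) + 2 \<le> length (U m)"
  using assms
proof (induction m arbitrary: t r rule: less_induct)
  case (less m)
  have main: "length (U t) + length (U r) + 2 \<le> length (U m)"
    if "t < r" "r < m" "X t \<noteq> X r" for t r
  proof -
    have "length (U (Suc r)) \<ge> length (U t) + length (U r) + 2"
      using last_occ_or_fresh[of r "X r"]
    proof
      assume "\<exists>k. last_occ r (X r) k"
      then obtain k where k: "last_occ r (X r) k" by blast
      then have "k < r" "X t \<noteq> X k" using that by (auto simp: last_occ_def)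
      then have "length (U t) + length (U k) + 2 \<le> length (U r)"
        using less.IH that by blast
      moreover have "length (h x r) + length (U k) = length (U r)"
        using h_last_occ[OF k] by (metis length_append)
      ultimately show ?thesis by (simp add: U_Suc)
    next
      assume "fresh r (X r)"
      then have "length (h x r) = Suc (length (U r))" by (simp add: h_fresh)
      moreover have "length (U t) < length (U r)" using that by (simp add: length_U_less_iff)
      ultimately show ?thesis by (simp add: U_Suc)
    qed
    also have "length (U (Suc r)) \<le> length (U m)" using that by (simp add: length_U_le_iff)
    finally show ?thesis .
  qed
  show ?case
  proof (cases "t < r")
    case True
    then show ?thesis using main less.prems by blast
  next
    case False
    then have "r < t" using less.prems(3) by (cases "r = t") auto
    then show ?thesis using main[of r t] less.prems by simp
  qed
qed

lemma set_U: "set (U n) \<subseteq> X ` {..<n}"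
proof (induction n)
  case (Suc n)
  have "set (h x n) \<subseteq> insert (X n) (set (U n))"
    using last_occ_or_fresh[of n "X n"]
  proof
    assume "\<exists>r. last_occ n (X n) r"
    then obtain r where "h x n @ U r = U n" using h_last_occ by blast
    then have "set (h x n) \<subseteq> set (U n)" by (metis Un_upper1 set_append)
    then show ?thesis by blast
  qed (simp add: h_fresh)
  then show ?case using Suc by (auto simp: U_Suc lessThan_Suc)
qed simp

text \<open>Both copies of \<open>v @ [X n]\<close> are extended to the left by \<open>t\<close>
  letters until the word is a prefix of \<open>s\<close>. Without its last letter the extended word
  is a suffix \<open>b\<close> of \<open>U n\<close>, hence some \<open>U k\<close> with
  \<open>X k = X n\<close>, and it contains \<open>v\<close>.\<close>

lemma earlier_occurrence:
  assumes "U n = q @ v" "i < length q" "subword s i (Suc (length v)) = v @ [X n]"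
  shows "\<exists>k<n. X k = X n \<and> length v \<le> length (U k)"
proof -
  have "iprefix (q @ v @ [X n]) s" using iprefix_U_X[of n] assms(1) by simp
  then have "v @ [X n] = subword s (length q) (Suc (length v))"
    by (simp add: iprefix_append[of q])
  from standard_extend_left[OF standard assms(2), of "Suc (length v)"] this assms(3)
  obtain t where t: "t \<le> i" "iprefix (subword s (length q - t) (Suc (length v) + t)) s"
    by auto
  define b where "b = subword s (length q - t) (length v + t)"
  have len: "length q - t + (length v + t) = length (U n)" using t assms by simp
  have "subword s 0 (length q - t) @ b @ [s (Suc (length (U n)))] = subword s 0 (Suc (length (U n)))"
    using subword_add[of s 0 "length q - t" "length v + t"] len by (simp add: b_def subword_Suc)
  also have "\<dots> = U n @ [X n]" using iprefix_U_X[of n] by (simp add: iprefix_def)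
  finally have "U n = subword s 0 (length q - t) @ b" "s (Suc (length (U n))) = X n"
    by simp_all
  moreover have "iprefix (b @ [X n]) s"
    using t(2) len \<open>s _ = X n\<close> by (simp add: subword_Suc b_def)
  \<comment> \<open>Since \<open>t\<close> is at most \<open>i\<close>, which is less than
    \<open>length q\<close>, the extension stops before the start of \<open>U n\<close>, so
    \<open>b\<close> is a proper suffix.\<close>
  moreover have "subword s 0 (length q - t) \<noteq> []"
    using t(1) assms(2) by (simp flip: length_0_conv)
  ultimately obtain k where "k < n" "b = U k" "X k = X n" using border_of_U by blast
  moreover from this have "length (U k) = length v + t" unfolding b_def by (metis length_subword)
  ultimately show ?thesis by auto
qed

end

section \<open>Single steps of the Crochemore factorization\<close>

lemma product_upto_Suc: "product_upto c (Suc k) = product_upto c k @ c (Suc k)"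
  by (simp add: product_upto_def)

text \<open>The occurrence at \<open>length q\<close> is always present, so a second one must start
  inside \<open>q\<close>. It may run past the end of \<open>q\<close>, which is why it is read off
  in \<open>w\<close>.\<close>

lemma repeated_next_iff:
  "repeated_next w q p \<longleftrightarrow>
     p \<noteq> [] \<and> iprefix (q @ p) w \<and> (\<exists>i<length q. subword w i (length p) = p)"
proof (cases "p \<noteq> [] \<and> iprefix (q @ p) w")
  case True
  have sub: "take (length p) (drop i (q @ p)) = subword w i (length p)" if "i \<le> length q" for i
  proof -
    have "q @ p = subword w 0 (i + (length p + (length q - i)))"
      using True that by (simp add: iprefix_def add.commute)
    also have "\<dots> = subword w 0 i @ subword w i (length p) @ subword w (i + length p) (length q - i)"
      by (simp add: subword_add)
    finally show ?thesis by simp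
  qed
  have occ: "occurrences p (q @ p) = {i. i \<le> length q \<and> subword w i (length p) = p}"
    unfolding occurrences_def using sub by auto
  have last: "length q \<in> occurrences p (q @ p)"
    by (simp add: occurrences_def)
  have fin: "finite (occurrences p (q @ p))"
    unfolding occ by (rule finite_subset[of _ "{..length q}"]) auto
  have "card (occurrences p (q @ p)) \<ge> 2 \<longleftrightarrow> (\<exists>i\<in>occurrences p (q @ p). i \<noteq> length q)"
  proof
    assume "card (occurrences p (q @ p)) \<ge> 2"
    then have "\<not> occurrences p (q @ p) \<subseteq> {length q}"
      using card_mono[of "{length q}" "occurrences p (q @ p)"] by fastforce
    then show "\<exists>i\<in>occurrences p (q @ p). i \<noteq> length q" by blast
  next
    assume "\<exists>i\<in>occurrences p (q @ p). i \<noteq> length q"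
    then obtain i where "{i, length q} \<subseteq> occurrences p (q @ p)" "i \<noteq> length q"
      using last by blast
    then show "card (occurrences p (q @ p)) \<ge> 2"
      using card_mono[OF fin, of "{i, length q}"] by simp
  qed
  then show ?thesis
    using True unfolding repeated_next_def occ by (auto simp: order_le_less)
qed (auto simp: repeated_next_def)

lemma crochemore_next:
  assumes "crochemore_factorization s c" "product_upto c k = q"
  shows "\<exists>p. repeated_next s q p \<Longrightarrow> is_arg_max length (repeated_next s q) (c (Suc k))"
    and "\<nexists>p. repeated_next s q p \<Longrightarrow> \<exists>a. a \<notin> set q \<and> c (Suc k) = [a]"
proof -
  have "if \<exists>p. repeated_next s q p
        then is_arg_max length (repeated_next s q) (c (Suc k))
        else (\<exists>a. a \<notin> set q \<and> c (Suc k) = [a])"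
    using assms(1)[unfolded crochemore_factorization_def, THEN conjunct2, rule_format, of "Suc k"]
    by (simp add: assms(2) Let_def)
  then show "\<exists>p. repeated_next s q p \<Longrightarrow> is_arg_max length (repeated_next s q) (c (Suc k))"
    and "\<nexists>p. repeated_next s q p \<Longrightarrow> \<exists>a. a \<notin> set q \<and> c (Suc k) = [a]"
    by (simp_all only: if_True if_False)
qed

lemma crochemore_longest:
  assumes "crochemore_factorization s c" "product_upto c k = q" "repeated_next s q v"
    and max: "\<And>p. repeated_next s q p \<Longrightarrow> length p \<le> length v"
  shows "c (Suc k) = v"
proof -
  have "is_arg_max length (repeated_next s q) (c (Suc k))"
    using crochemore_next(1)[OF assms(1,2)] assms(3) by blast
  then have c: "repeated_next s q (c (Suc k))" "\<not> length (c (Suc k)) < length v"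
    using assms(3) by (auto simp: is_arg_max_def)
  then have "length (c (Suc k)) = length v" using max by fastforce
  moreover have "iprefix (q @ c (Suc k)) s" "iprefix (q @ v) s"
    using c assms(3) by (auto simp: repeated_next_def)
  ultimately show ?thesis by (simp add: iprefix_append)
qed

text \<open>A repeated \<open>p\<close> would begin with \<open>a\<close>, and its earlier copy
  would start inside \<open>q\<close>, where \<open>a\<close> is absent.\<close>

lemma crochemore_new_letter:
  assumes "crochemore_factorization s c" "product_upto c k = q" "iprefix (q @ [a]) s" "a \<notin> set q"
  shows "c (Suc k) = [a]"
proof -
  have "\<not> repeated_next s q p" for p
  proof
    assume "repeated_next s q p"
    then obtain i where p: "p \<noteq> []" "iprefix (q @ p) s" "i < length q" "subword s i (length p) = p"
      by (auto simp: repeated_next_iff)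
    then have "hd p = s (Suc i)"
      by (metis length_greater_0_conv Suc_pred subword_Cons list.sel(1))
    moreover have "hd p = s (Suc (length q))"
      using p(1,2) unfolding iprefix_append
      by (metis length_greater_0_conv Suc_pred subword_Cons list.sel(1))
    moreover have "a = s (Suc (length q))"
      using assms(3) by (simp add: iprefix_append subword_def)
    moreover have "q = subword s 0 (length q)" using p(2) by (simp only: iprefix_append) (simp only: iprefix_def)
    then have "q ! i = s (Suc i)" using nth_subword[OF p(3), of s 0] by simp
    ultimately show False using assms(4) p(3) by (metis nth_mem)
  qed
  then obtain b where b: "c (Suc k) = [b]"
    using crochemore_next(2)[OF assms(1,2)] by blast
  \<comment> \<open>The definition only provides some letter outside \<open>q\<close>; it is
    \<open>a\<close> because the products are prefixes of \<open>s\<close>.\<close>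
  have "iprefix (product_upto c (Suc k)) s"
    using assms(1) by (simp add: crochemore_factorization_def infinite_product_def)
  then have "iprefix (q @ [b]) s" using b assms(2) by (simp add: product_upto_Suc)
  then show ?thesis using b assms(3) by (simp add: iprefix_append)
qed

lemma word_power_Suc: "word_power v (Suc n) = v @ word_power v n"
  by (simp add: word_power_def)

lemma word_power_Suc_right: "word_power v (Suc n) = word_power v n @ v"
  by (simp add: word_power_def flip: replicate_append_same)

section \<open>Factors produced by a run of the directive word\<close>

context directed_word
begin

text \<open>A repeated word longer than \<open>v\<close> must begin with \<open>v @ [X n]\<close>,
  because \<open>X n\<close> follows \<open>U n\<close> in \<open>s\<close>. By
  \<open>earlier_occurrence\<close> some \<open>U k\<close> with \<open>X k = X n\<close> would then
  be at least as long as \<open>v\<close>.\<close>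

lemma crochemore_step:
  assumes c: "crochemore_factorization s c" "product_upto c k = q"
    and U: "U n = q @ v" and v: "v \<noteq> []"
    and i: "i < length q" "subword s i (length v) = v"
    and long: "\<And>k. k < n \<Longrightarrow> X k = X n \<Longrightarrow> length (U k) < length v"
  shows "product_upto c (Suc k) = U n"
proof -
  have "length p \<le> length v" if p: "repeated_next s q p" for p
  proof (rule ccontr)
    assume "\<not> length p \<le> length v"
    then obtain e where e: "length p = Suc (length v) + e"
      using less_iff_Suc_add[of "length v" "length p"] by auto
    obtain t where t: "iprefix (q @ p) s" "t < length q" "subword s t (length p) = p"
      using p by (auto simp: repeated_next_iff)
    have "subword s (length q) (length p) = subword s t (length p)"
      using t by (simp add: iprefix_append)
    then have "subword s (length q) (Suc (length v)) = subword s t (Suc (length v))"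
      unfolding e subword_add by simp
    moreover have "subword s (length q) (Suc (length v)) = v @ [X n]"
      using iprefix_U_X[of n] U by (simp add: iprefix_append[of q])
    ultimately obtain k where "k < n" "X k = X n" "length v \<le> length (U k)"
      using earlier_occurrence[OF U t(2)] by auto
    then show False using long by fastforce
  qed
  moreover have "repeated_next s q v"
    using v i U iprefix_U[of n] by (auto simp: repeated_next_iff)
  ultimately have "c (Suc k) = v" using crochemore_longest[OF c] by blast
  then show ?thesis using c(2) U by (simp add: product_upto_Suc)
qed

lemma before_run:
  assumes "\<And>t. t < d \<Longrightarrow> X (m + t) = X m" "k < m + d" "X k \<noteq> X m"
  shows "k < m"
proof (rule ccontr)
  assume "\<not> k < m"
  then have "k - m < d" "m + (k - m) = k" using assms(2) by auto
  then show False using assms(1)[of "k - m"] assms(3) by simp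
qed

text \<open>With \<open>r\<close> the last index before \<open>m\<close> carrying
  \<open>X m\<close>, \<open>U (m + d)\<close> is \<open>U r\<close> followed by
  \<open>d + 1\<close> copies of \<open>rev (h x m)\<close>. So the last \<open>d\<close> copies
  also occur at \<open>length (U r)\<close>. An earlier index \<open>k\<close> with the next letter
  lies before \<open>m\<close>, and \<open>length_U_two_letters\<close> makes \<open>U k\<close>
  shorter than \<open>h x m\<close>.\<close>

lemma crochemore_old_run:
  assumes c: "crochemore_factorization s c" "product_upto c k = U m"
    and d: "d \<ge> 1" "\<And>t. t < d \<Longrightarrow> X (m + t) = X m" "X (m + d) \<noteq> X m"
    and old: "\<not> fresh m (X m)"
  shows "product_upto c (Suc k) = U (m + d)"
proof -
  obtain r where r: "last_occ m (X m) r" using last_occ_or_fresh old by blast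
  define v where "v = word_power (rev (h x m)) d"
  have U: "U (m + d) = U m @ v" unfolding v_def using d(2) by (rule run_U)
  have Um: "U m = U r @ rev (h x m)" using h_last_occ[OF r] by (metis rev_U rev_append)
  have rm: "r < m" "X r = X m" using r by (auto simp: last_occ_def)
  then have hne: "h x m \<noteq> []" using Um length_U_less_iff[of r m] by auto
  obtain e where e: "d = Suc e" using d(1) by (cases d) auto
  have lv: "length (h x m) \<le> length v" unfolding v_def e word_power_Suc by simp
  have "U (m + d) = U r @ v @ rev (h x m)"
    unfolding U Um v_def using word_power_Suc[of "rev (h x m)" d] word_power_Suc_right[of "rev (h x m)" d]
    by simp
  then have "iprefix (U r @ v) s" using iprefix_U[of "m + d"] by (metis append.assoc iprefix_append)
  then have "subword s (length (U r)) (length v) = v" by (simp add: iprefix_append)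
  moreover have "length (U k) < length v" if k: "k < m + d" "X k = X (m + d)" for k
  proof -
    have "k < m" using before_run[OF d(2) k(1)] d(3) k(2) by simp
    then have "length (U k) + length (U r) + 2 \<le> length (U m)"
      using length_U_two_letters[of k m r] rm d(3) k by simp
    then show ?thesis using Um lv by simp
  qed
  ultimately show ?thesis
    using rm(1) hne lv by (intro crochemore_step[OF c U, of "length (U r)"]) (auto simp: length_U_less_iff)
qed

text \<open>The letter \<open>X m\<close> is a factor by itself. As \<open>h x m\<close> is
  \<open>U m @ [X m]\<close>, the rest of the run is \<open>U (m + d - 1)\<close>, which already
  occurs at position 0 and, if nonempty, is the next factor.\<close>

lemma crochemore_new_run:
  assumes c: "crochemore_factorization s c" "product_upto c k = U m"
    and d: "d \<ge> 1" "\<And>t. t < d \<Longrightarrow> X (m + t) = X m" "X (m + d) \<noteq> X m"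
    and new: "fresh m (X m)"
  shows "\<exists>k'. product_upto c k' = U (m + d)"
proof -
  have "X m \<notin> set (U m)" using set_U[of m] new unfolding fresh_def by fastforce
  then have "c (Suc k) = [X m]" using crochemore_new_letter[OF c iprefix_U_X] by simp
  then have ck: "product_upto c (Suc k) = U m @ [X m]" using c(2) by (simp add: product_upto_Suc)
  have hm: "rev (h x m) = X m # U m" using h_fresh[OF new] by simp
  obtain e where e: "d = Suc e" using d(1) by (cases d) auto
  define v where "v = U m @ word_power (X m # U m) e"
  have "U (m + d) = U m @ word_power (rev (h x m)) d" using d(2) by (rule run_U)
  then have U: "U (m + d) = (U m @ [X m]) @ v"
    unfolding hm e word_power_Suc v_def by simp
  have "U (m + e) = v"
    unfolding v_def hm[symmetric] using d(2) e by (intro run_U) simp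
  then have sv: "subword s 0 (length v) = v" using iprefix_U[of "m + e"] by (simp add: iprefix_def)
  show ?thesis
  \<comment> \<open>Emptiness means \<open>m = 0\<close> and \<open>d = 1\<close>: the new letter
    alone completes the run.\<close>
  proof (cases "v = []")
    case True
    then show ?thesis using ck U by auto
  next
    case False
    have "length (U k) < length v" if k: "k < m + d" "X k = X (m + d)" for k
    proof -
      have "k < m" using before_run[OF d(2) k(1)] d(3) k(2) by simp
      then show ?thesis using length_U_less_iff[of k m] by (simp add: v_def)
    qed
    then show ?thesis using crochemore_step[OF c(1) ck U False _ sv] by auto
  qed
qed

end

section \<open>Run boundaries in the directive word\<close>

lemma g_Suc: "m \<ge> 1 \<Longrightarrow> g d (Suc m) = g d m + d m"
  by (simp add: g_def)

lemma length_product_runs: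
  "length (product_upto (\<lambda>m. word_power [y m] (d m)) n) = g d (Suc n) - 1"
  by (induction n) (simp_all add: product_upto_Suc g_Suc product_upto_def g_def word_power_def)

lemma runs_nth:
  assumes "infinite_product x (\<lambda>m. word_power [y m] (d m))" "m \<ge> 1" "t < d m"
  shows "x (g d m + t) = y m"
proof -
  obtain n where n: "m = Suc n" using assms(2) by (cases m) auto
  let ?P = "product_upto (\<lambda>m. word_power [y m] (d m)) n"
  have "iprefix (?P @ word_power [y m] (d m)) x"
    using assms(1)[unfolded infinite_product_def, THEN conjunct1, THEN spec, of "Suc n"]
    by (simp add: product_upto_Suc n)
  then have "word_power [y m] (d m) = subword x (length ?P) (length (word_power [y m] (d m)))"
    by (simp only: iprefix_append)
  moreover have "length (word_power [y m] (d m)) = d m" by (simp add: word_power_def)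
  ultimately have "word_power [y m] (d m) = subword x (g d m - 1) (d m)"
    by (simp only: length_product_runs n)
  then have "word_power [y m] (d m) ! t = x (g d m - 1 + t + 1)" using assms(3) by simp
  moreover have "word_power [y m] (d m) = replicate (d m) (y m)"
    by (simp add: word_power_def)
  moreover have "g d m \<ge> 1" by (simp add: g_def)
  ultimately show ?thesis using assms(3) by simp
qed

text \<open>Finitely many indices \<open>C\<close> already realize all values of \<open>f\<close>;
  beyond the largest of them every value is a repetition.\<close>

lemma finite_range_eventually_old:
  fixes f :: "nat \<Rightarrow> 'a"
  assumes "finite A" "\<And>m. m \<ge> 1 \<Longrightarrow> f m \<in> A"
  shows "\<exists>i\<ge>1. \<forall>m\<ge>i. \<exists>l\<ge>1. l < m \<and> f l = f m"
proof -
  have "finite (f ` {1..})" by (rule finite_subset[OF _ assms(1)]) (use assms(2) in auto)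
  from finite_subset_image[OF this subset_refl] obtain C
    where C: "C \<subseteq> {1..}" "finite C" "f ` {1..} = f ` C" by auto
  have "\<exists>l\<ge>1. l < m \<and> f l = f m" if m: "Suc (Max (insert 0 C)) \<le> m" for m
  proof -
    have "f m \<in> f ` C" using m unfolding C(3)[symmetric] by simp
    then obtain l where l: "l \<in> C" "f l = f m" by force
    then have "l \<le> Max (insert 0 C)" using C(2) by simp
    then show ?thesis using l C(1) m by auto
  qed
  then show ?thesis by (intro exI[of _ "Suc (Max (insert 0 C))"]) simp
qed

theorem theorem2:
  fixes A :: "'a set" and s x y :: "'a iword" and d :: "nat \<Rightarrow> nat" and c :: "nat \<Rightarrow> 'a list"
  assumes "finite A"
    and "word_over A s" and "word_over A x" and "word_over A y"
    and "standard_episturmian s"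
    and "directive_word s x"
    and "infinite_product x (\<lambda>m. word_power [y m] (d m))"
    and "\<forall>m\<ge>1. d m \<ge> 1"
    and "\<forall>m\<ge>1. y m \<noteq> y (m + 1)"
    and "crochemore_factorization s c"
  shows "\<exists>i\<ge>1. \<exists>j\<ge>1.
           (\<forall>k\<ge>j. product_upto c k = pal_prefix s (g d (k - j + i + 1))) \<and>
           (\<forall>k\<ge>j. c k = word_power (rev (h x (g d (k - j + i) - 1))) (d (k - j + i)))"
proof -
  interpret directed_word s x using assms(5,6) by unfold_locales
  \<comment> \<open>Zero-based start of run \<open>m\<close>, so that
    \<open>pal_prefix s (g d m)\<close> is \<open>U (G m)\<close>.\<close>
  define G where "G m = g d m - 1" for m
  have g_G: "g d m = Suc (G m)" for m by (simp add: G_def g_def)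
  have G_Suc: "G (Suc m) = G m + d m" if "m \<ge> 1" for m
    using that g_Suc[of m d] by (simp add: g_G)
  have G_mono: "G m \<le> G (m + e)" if "m \<ge> 1" for m e
    using that by (induction e) (simp_all add: G_Suc)
  have X: "X (G m + t) = y m" if "m \<ge> 1" "t < d m" for m t
    using runs_nth[OF assms(7) that] by (simp add: X_def g_G)
  have run: "X (G m + t) = X (G m)" if "m \<ge> 1" "t < d m" for m t
    using X[OF that] X[of m 0] that by simp
  have XG: "X (G m) = y m" if "m \<ge> 1" for m
    using X[of m 0] assms(8) that by fastforce
  have run_end: "X (G m + d m) \<noteq> X (G m)" if "m \<ge> 1" for m
    using XG[of "Suc m"] XG[of m] G_Suc[of m] assms(9)[rule_format, of m] that by simp
  have "y m \<in> A" if "m \<ge> 1" for m using assms(4) that by (simp add: word_over_def)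
  then obtain i where i: "i \<ge> 1" "\<And>m. m \<ge> i \<Longrightarrow> \<exists>l\<ge>1. l < m \<and> y l = y m"
    using finite_range_eventually_old[OF assms(1), of y] by blast
  have old: "\<not> fresh (G m) (X (G m))" if "m \<ge> i" for m
  proof -
    obtain l where l: "l \<ge> 1" "l < m" "y l = y m" using i(2) \<open>m \<ge> i\<close> by blast
    have "G l < G (Suc l)" using G_Suc[of l] assms(8) l(1) by fastforce
    also have "\<dots> \<le> G m" using G_mono[of "Suc l" "m - Suc l"] l by simp
    finally show ?thesis using l XG unfolding fresh_def by force
  qed
  \<comment> \<open>A new letter may cost an extra factor, so the number \<open>k\<close> of factors
    is not determined by the number of runs; but every run boundary is hit.\<close>
  have reach: "\<exists>k. product_upto c k = U (G (Suc n))" for n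
  proof (induction n)
    case 0
    show ?case by (rule exI[of _ 0]) (simp add: product_upto_def G_def g_def)
  next
    case (Suc n)
    then obtain k where k: "product_upto c k = U (G (Suc n))" by blast
    have "\<exists>k'. product_upto c k' = U (G (Suc n) + d (Suc n))"
    proof (cases "fresh (G (Suc n)) (X (G (Suc n)))")
      case True
      then show ?thesis
        using crochemore_new_run[OF assms(10) k, of "d (Suc n)"] run[of "Suc n"] run_end[of "Suc n"] assms(8)
        by simp
    next
      case False
      then show ?thesis
        using crochemore_old_run[OF assms(10) k, of "d (Suc n)"] run[of "Suc n"] run_end[of "Suc n"] assms(8)
        by auto
    qed
    then show ?case by (simp add: G_Suc)
  qed
  obtain l where l: "product_upto c l = U (G i)"
    using reach[of "i - 1"] i(1) by auto
  \<comment> \<open>From run \<open>i\<close> on all letters are old, so factors and runs advance in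
    step.\<close>
  have sync: "product_upto c (l + n) = U (G (i + n))" for n
  proof (induction n)
    case (Suc n)
    then show ?case
      using crochemore_old_run[OF assms(10) Suc, of "d (i + n)"] run[of "i + n"] run_end[of "i + n"]
        assms(8) old[of "i + n"] i(1) G_Suc[of "i + n"] by simp
  qed (simp add: l)
  \<comment> \<open>The witness for \<open>j\<close> is \<open>Suc l\<close>: the factor with this
    index is the first one known to be a whole run, namely run \<open>i\<close>.\<close>
  have first: "product_upto c k = pal_prefix s (g d (k - Suc l + i + 1))" if "k \<ge> Suc l" for k
    using sync[of "Suc (k - Suc l)"] that by (simp add: U_def g_G add.commute)
  have second: "c k = word_power (rev (h x (g d (k - Suc l + i) - 1))) (d (k - Suc l + i))"
    if "k \<ge> Suc l" for k
  proof -
    define n where "n = k - Suc l"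
    have k: "k = Suc (l + n)" using that by (simp add: n_def)
    \<comment> \<open>Two consecutive products are compared, and the common prefix
      \<open>U (G (i + n))\<close> cancels.\<close>
    have "U (G (i + n)) @ c k = U (G (i + n) + d (i + n))"
      using sync[of n] sync[of "Suc n"] G_Suc[of "i + n"] i(1) by (simp add: k product_upto_Suc)
    also have "\<dots> = U (G (i + n)) @ word_power (rev (h x (G (i + n)))) (d (i + n))"
      using run[of "i + n"] i(1) by (intro run_U) simp
    finally show ?thesis by (simp add: n_def g_G add.commute)
  qed
  show ?thesis using i(1) first second by (intro exI[of _ i] exI[of _ "Suc l"] conjI) auto
qed

end
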